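(* Let $U$ be an optimal machine. There exists some $\varepsilon>0$ such that no randomized algorithm computes, with positive probability, a function $\alpha$ with $\overline{E}(\alpha,\mathrm{dom}(U))<\varepsilon$.
   Context: A machine is a partial computable function from binary strings to binary strings; for a machine $V$ let $C_V(x)=\min\{|p|\colon V(p)=x\}$ (plain Kolmogorov complexity with respect to $V$). $U$ is optimal if for every machine $V$ there is $c$ with $C_U(x)\le C_V(x)+c$ for all $x$. For a set $A$ of strings and a function $\alpha$ on strings, $\varepsilon_n$ is the fraction of strings of length at most $n$ where $\alpha$ and the characteristic function of $A$ differ (points where $\alpha$ is undefined count as errors), and $\overline{E}(\alpha,A)=\limsup_n\varepsilon_n$. A randomized algorithm is an oracle machine run with a uniformly random oracle (independent fair coin tosses). *)

theory Defs
  imports "HOL-Probability.Probability"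
begin

text \<open>Bijective base-2 coding of binary strings (bool lists) as naturals.\<close>
fun str_to_nat :: "bool list \<Rightarrow> nat" where
  "str_to_nat [] = 0"
| "str_to_nat (b # s) = 2 * str_to_nat s + (if b then 2 else 1)"

definition nat_to_str :: "nat \<Rightarrow> bool list" where
  "nat_to_str = inv str_to_nat"

datatype recf = Zero | Succ | Proj nat | Comp recf "recf list" | Prim recf recf | Mu recf | Orc

definition arg0 :: "nat list \<Rightarrow> nat" where
  "arg0 xs = (if xs = [] then 0 else hd xs)"

inductive reval :: "(nat \<Rightarrow> bool) \<Rightarrow> recf \<Rightarrow> nat list \<Rightarrow> nat \<Rightarrow> bool" for w where
  "reval w Zero xs 0"
| "reval w Succ xs (Suc (arg0 xs))"
| "i < length xs \<Longrightarrow> reval w (Proj i) xs (xs ! i)"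
| "list_all2 (\<lambda>g y. reval w g xs y) gs ys \<Longrightarrow> reval w f ys z \<Longrightarrow> reval w (Comp f gs) xs z"
| "reval w f xs y \<Longrightarrow> reval w (Prim f g) (0 # xs) y"
| "reval w (Prim f g) (n # xs) y \<Longrightarrow> reval w g (y # n # xs) z \<Longrightarrow> reval w (Prim f g) (Suc n # xs) z"
| "reval w f (n # xs) 0 \<Longrightarrow> (\<forall>m<n. \<exists>y. reval w f (m # xs) y \<and> y \<noteq> 0) \<Longrightarrow> reval w (Mu f) xs n"
| "reval w Orc xs (if w (arg0 xs) then 1 else 0)"

fun oracle_free :: "recf \<Rightarrow> bool" where
  "oracle_free Orc = False"
| "oracle_free (Comp f gs) = (oracle_free f \<and> (\<forall>g\<in>set gs. oracle_free g))"
| "oracle_free (Prim f g) = (oracle_free f \<and> oracle_free g)"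
| "oracle_free (Mu f) = oracle_free f"
| "oracle_free _ = True"

definition compute :: "(nat \<Rightarrow> bool) \<Rightarrow> recf \<Rightarrow> nat \<Rightarrow> nat option" where
  "compute w f x = (if \<exists>y. reval w f [x] y then Some (THE y. reval w f [x] y) else None)"

definition machine :: "(bool list \<Rightarrow> bool list option) \<Rightarrow> bool" where
  "machine V \<longleftrightarrow> (\<exists>f. oracle_free f \<and>
     (\<forall>p. V p = map_option nat_to_str (compute (\<lambda>_. False) f (str_to_nat p))))"

definition C :: "(bool list \<Rightarrow> bool list option) \<Rightarrow> bool list \<Rightarrow> enat" where
  "C V x = (if \<exists>p. V p = Some x then enat (LEAST l. \<exists>p. V p = Some x \<and> length p = l) else \<infinity>)"

definition optimal :: "(bool list \<Rightarrow> bool list option) \<Rightarrow> bool" where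
  "optimal U \<longleftrightarrow> machine U \<and>
     (\<forall>V. machine V \<longrightarrow> (\<exists>c::nat. \<forall>x. C U x \<le> C V x + enat c))"

text \<open>Fraction of strings of length at most n where alpha differs from the
  characteristic function of A (1 on A, 0 off A); undefined counts as error.\<close>
definition err_frac :: "(bool list \<Rightarrow> nat option) \<Rightarrow> bool list set \<Rightarrow> nat \<Rightarrow> real" where
  "err_frac \<alpha> A n =
     real (card {x. length x \<le> n \<and> \<alpha> x \<noteq> Some (if x \<in> A then 1 else 0)})
     / real (card {x::bool list. length x \<le> n})"

definition upper_err :: "(bool list \<Rightarrow> nat option) \<Rightarrow> bool list set \<Rightarrow> ereal" where
  "upper_err \<alpha> A = limsup (\<lambda>n. ereal (err_frac \<alpha> A n))"

definition coin_space :: "(nat \<Rightarrow> bool) measure" where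
  "coin_space = PiM UNIV (\<lambda>_. measure_pmf (bernoulli_pmf (1/2)))"

definition rand_fun :: "recf \<Rightarrow> (nat \<Rightarrow> bool) \<Rightarrow> bool list \<Rightarrow> nat option" where
  "rand_fun f w x = compute w f (str_to_nat x)"

end

theory Submission
  imports Defs
begin

text \<open>Let \<open>V\<close> map a string \<open>p\<close> to \<open>U(q) + p + 1\<close>, where the program \<open>q\<close> is the string with number
  \<open>m = |p|\<close>, and let \<open>c\<close> be the constant with which \<open>U\<close> simulates \<open>V\<close>. If \<open>U(q) = s\<close> then all numbers
  in an interval of length \<open>2 ^ m\<close> above \<open>s\<close> have \<open>U\<close>-programs of length at most \<open>m + c\<close>, so a fraction
  of at least about \<open>2 ^ (- c)\<close> of the programs of length at most \<open>m + c\<close> halt with output above \<open>s\<close>.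

  Suppose that with positive probability \<open>g\<close> a randomized algorithm \<open>\<alpha>\<close> errs on a fraction of at most
  \<open>2 ^ (- c - 3)\<close> of the strings of each length bound \<open>n \<ge> N\<close>. Waiting until all but this fraction of
  the answers of \<open>\<alpha>\<close> have appeared, with the positive ones confirmed by running \<open>U\<close>, yields a number
  \<open>s\<close> such that, for a good oracle, only unsettled strings and errors of \<open>\<alpha>\<close> can have an output
  above \<open>s\<close>. To do this deterministically for all \<open>n\<close> up to \<open>2 ^ (2 k + 1) + k\<close>, wait until the
  probability of having reached this stage exceeds a threshold \<open>j / 2 ^ k\<close> that is within \<open>g\<close> of its
  limit: a good oracle must then be among those that have reached it. Since \<open>j\<close> has only \<open>k\<close> bits, the
  resulting \<open>s\<close> is \<open>U(q)\<close> for some \<open>q\<close> of length at most \<open>2 k\<close>, and this contradicts the lower bound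
  for \<open>n = m + c\<close>, where \<open>m\<close> is the number of \<open>q\<close>.\<close>

section \<open>Step-bounded evaluation\<close>

text \<open>The first \<open>s\<close> oracle bits, least significant first, packed into one number,
  so that a recursive function can run through all \<open>2 ^ s\<close> finite pieces of the
  oracle.\<close>

definition pre :: "nat \<Rightarrow> (nat \<Rightarrow> bool) \<Rightarrow> nat" where
  "pre s w = horner_sum of_bool 2 (map w [0..<s])"

lemma odd_pre_div: "i < s \<Longrightarrow> odd (pre s w div 2 ^ i) \<longleftrightarrow> w i"
  unfolding pre_def bit_iff_odd[symmetric] by (simp add: bit_horner_sum_bit_iff)

lemma pre_less: "pre s w < 2 ^ s"
  unfolding pre_def using horner_sum_of_bool_2_less[of "map w [0..<s]"] by simp

lemma pre_eq_iff: "a < 2 ^ s \<Longrightarrow> pre s w = a \<longleftrightarrow> (\<forall>i<s. w i \<longleftrightarrow> odd (a div 2 ^ i))"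
proof
  assume a: "a < 2 ^ s" and *: "\<forall>i<s. w i \<longleftrightarrow> odd (a div 2 ^ i)"
  show "pre s w = a"
  proof (rule bit_eqI)
    fix n :: nat
    show "bit (pre s w) n \<longleftrightarrow> bit a n"
    proof (cases "n < s")
      case True
      then show ?thesis using * odd_pre_div[of n s w] by (simp add: bit_iff_odd)
    next
      case False
      then have "(2::nat) ^ s \<le> 2 ^ n" by simp
      then have "a div 2 ^ n = 0" "pre s w div 2 ^ n = 0"
        using a pre_less[of s w] by (meson div_less less_le_trans)+
      then show ?thesis by (simp add: bit_iff_odd)
    qed
  qed
qed (use odd_pre_div in blast)

lemma pre_False [simp]: "pre s (\<lambda>_. False) = 0"
  by (subst pre_eq_iff) auto

text \<open>Evaluation with step bound \<open>s\<close> and a finite piece of the oracle: \<open>0\<close> means that there is no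
  result yet and \<open>Suc y\<close> is the result \<open>y\<close>. The oracle is known only below \<open>s\<close>, where its values are
  the binary digits of \<open>a\<close>.\<close>
fun sim :: "nat \<Rightarrow> nat \<Rightarrow> recf \<Rightarrow> nat list \<Rightarrow> nat" where
  "sim s a Zero xs = 1"
| "sim s a Succ xs = Suc (Suc (arg0 xs))"
| "sim s a (Proj i) xs = (if i < length xs then Suc (xs ! i) else 0)"
| "sim s a (Comp f gs) xs =
     (if \<forall>g\<in>set gs. sim s a g xs \<noteq> 0 then sim s a f (map (\<lambda>g. sim s a g xs - 1) gs) else 0)"
| "sim s a (Prim f g) xs =
     (if xs = [] then 0
      else rec_nat (sim s a f (tl xs))
             (\<lambda>i y. case y of 0 \<Rightarrow> 0 | Suc v \<Rightarrow> sim s a g (v # i # tl xs)) (hd xs))"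
| "sim s a (Mu f) xs =
     (\<Sum>n<s. if sim s a f (n # xs) = Suc 0 \<and> (\<forall>m<n. Suc 0 < sim s a f (m # xs)) then Suc n else 0)"
| "sim s a Orc xs = (if arg0 xs < s then Suc (if odd (a div 2 ^ arg0 xs) then 1 else 0) else 0)"

lemma sim_Prim [simp]:
  "sim s a (Prim f g) [] = 0"
  "sim s a (Prim f g) (0 # xs) = sim s a f xs"
  "sim s a (Prim f g) (Suc n # xs) =
     (case sim s a (Prim f g) (n # xs) of 0 \<Rightarrow> 0 | Suc y \<Rightarrow> sim s a g (y # n # xs))"
  by (simp_all split: nat.split)

declare sim.simps(5) [simp del]

text \<open>At most one summand is nonzero, because a first zero is unique. The sum in the
  \<open>Mu\<close> clause of \<open>sim\<close> is therefore a bounded search, written in a form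
  that is visibly recursive.\<close>

lemma sum_first_hit:
  fixes F :: "nat \<Rightarrow> nat"
  assumes "n < s" "F n = Suc 0" "\<forall>m<n. Suc 0 < F m"
  shows "(\<Sum>n<s. if F n = Suc 0 \<and> (\<forall>m<n. Suc 0 < F m) then Suc n else 0) = Suc n"
proof -
  have "(if F i = Suc 0 \<and> (\<forall>m<i. Suc 0 < F m) then Suc i else 0) = (if i = n then Suc n else 0)" for i
    using assms by (metis less_irrefl linorder_neqE_nat)
  then show ?thesis using assms(1) by simp
qed

text \<open>A derivation involves finitely many subcomputations, candidates and oracle queries, so
  every large bound covers them all. Claiming all large \<open>s\<close> instead of some
  \<open>s\<close> lets finitely many subresults be combined at a common bound.\<close>

lemma reval_sim: "reval w f xs y \<Longrightarrow> \<forall>\<^sub>F s in sequentially. sim s (pre s w) f xs = Suc y"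
proof (induction rule: reval.induct)
  case (4 xs gs ys f z)
  have "\<forall>\<^sub>F s in sequentially. \<forall>i\<in>{..<length gs}. sim s (pre s w) (gs ! i) xs = Suc (ys ! i)"
    using "4.IH"(1) by (intro eventually_ball_finite) (auto simp: list_all2_conv_all_nth)
  then show ?case using "4.IH"(2)
  proof eventually_elim
    case (elim s)
    have "map (\<lambda>g. sim s (pre s w) g xs - 1) gs = ys"
      using elim(1) "4.IH"(1) by (intro nth_equalityI) (auto simp: list_all2_conv_all_nth)
    moreover have "\<forall>g\<in>set gs. sim s (pre s w) g xs \<noteq> 0"
      using elim(1) by (auto simp: in_set_conv_nth)
    ultimately show ?case using elim(2) by simp
  qed
next
  case (6 f g n xs y z)
  from "6.IH" show ?case by eventually_elim simp
next
  case (7 f n xs)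
  obtain Y where Y: "\<forall>m<n. (\<forall>\<^sub>F s in sequentially. sim s (pre s w) f (m # xs) = Suc (Y m)) \<and> Y m \<noteq> 0"
    using "7.IH"(2) by metis
  then have "\<forall>\<^sub>F s in sequentially. \<forall>m\<in>{..<n}. sim s (pre s w) f (m # xs) = Suc (Y m)"
    by (intro eventually_ball_finite) auto
  then show ?case using "7.IH"(1) eventually_gt_at_top[of n]
  proof eventually_elim
    case (elim s)
    then show ?case using Y by (simp add: sum_first_hit)
  qed
next
  case (8 xs)
  show ?case using eventually_gt_at_top[of "arg0 xs"]
    by eventually_elim (simp add: odd_pre_div)
qed auto

text \<open>A result at a single bound is already correct: the values found by \<open>sim\<close>
  assemble into a derivation, and the oracle bits it uses are genuine bits of
  \<open>w\<close>.\<close>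

lemma sim_reval: "sim s (pre s w) f xs = Suc y \<Longrightarrow> reval w f xs y"
proof (induction f arbitrary: xs y)
  case Zero
  then show ?case by (auto intro: reval.intros)
next
  case Succ
  then show ?case by (auto intro: reval.intros)
next
  case (Proj i)
  then show ?case by (auto intro: reval.intros split: if_splits)
next
  case (Comp f gs)
  have nz: "\<forall>g\<in>set gs. sim s (pre s w) g xs \<noteq> 0"
    and f: "sim s (pre s w) f (map (\<lambda>g. sim s (pre s w) g xs - 1) gs) = Suc y"
    using Comp.prems by (auto split: if_splits)
  show ?case
  proof (rule reval.intros(4))
    show "reval w f (map (\<lambda>g. sim s (pre s w) g xs - 1) gs) y" by (rule Comp.IH(1)[OF f])
    show "list_all2 (\<lambda>g y. reval w g xs y) gs (map (\<lambda>g. sim s (pre s w) g xs - 1) gs)"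
      using nz Comp.IH(2) by (auto simp: list_all2_map2 intro!: list.rel_refl_strong)
  qed
next
  case (Prim f g)
  then obtain n xs' where xs: "xs = n # xs'" by (cases xs) auto
  have "sim s (pre s w) (Prim f g) (n # xs') = Suc y \<Longrightarrow> reval w (Prim f g) (n # xs') y" for y
  proof (induction n arbitrary: y)
    case 0
    then show ?case by (auto intro: reval.intros(5) Prim.IH(1))
  next
    case (Suc n)
    then show ?case by (auto intro: reval.intros(6) Prim.IH(2) split: nat.splits)
  qed
  then show ?case using Prim.prems xs by simp
next
  case (Mu f)
  let ?F = "\<lambda>n. sim s (pre s w) f (n # xs)"
  let ?P = "\<lambda>n. ?F n = Suc 0 \<and> (\<forall>m<n. Suc 0 < ?F m)"
  have "\<exists>n<s. ?P n"
  proof (rule ccontr)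
    assume "\<not> (\<exists>n<s. ?P n)"
    then have "(\<Sum>n<s. if ?P n then Suc n else 0) = 0"
      by (intro sum.neutral ballI if_not_P) (simp only: lessThan_iff, iprover)
    then show False using Mu.prems by (simp only: sim.simps nat.simps)
  qed
  then obtain n where n: "n < s" "?F n = Suc 0" "\<forall>m<n. Suc 0 < ?F m"
    by (elim exE conjE)
  have "Suc y = Suc n" using Mu.prems unfolding sim.simps
    by (rule trans[OF sym]) (rule sum_first_hit[where F = ?F, OF n])
  then have "y = n" by simp
  have "reval w f (m # xs) (?F m - 1) \<and> ?F m - 1 \<noteq> 0" if "m < n" for m
  proof -
    have "Suc 0 < ?F m" using n(3) that by blast
    then show ?thesis by (simp add: Mu.IH)
  qed
  then have "\<forall>m<n. \<exists>y. reval w f (m # xs) y \<and> y \<noteq> 0" by iprover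
  then show ?case unfolding \<open>y = n\<close>
    by (rule reval.intros(7)[rotated]) (rule Mu.IH[OF n(2)])
next
  case Orc
  then have "y = (if w (arg0 xs) then 1 else 0)"
    by (auto simp: odd_pre_div split: if_splits)
  then show ?case by (simp only: reval.intros)
qed

text \<open>The right-hand side is a countable combination of conditions on finitely many oracle
  bits; this is what makes the behaviour of an oracle program measurable.\<close>

lemma reval_iff_sim: "reval w f xs y \<longleftrightarrow> (\<forall>\<^sub>F s in sequentially. sim s (pre s w) f xs = Suc y)"
  by (metis (mono_tags, lifting) reval_sim sim_reval eventually_happens' sequentially_bot)

lemma reval_deterministic:
  assumes "reval w f xs y" "reval w f xs z"
  shows "y = z"
proof -
  have "\<forall>\<^sub>F s in sequentially. Suc y = Suc z"
    using reval_sim[OF assms(1)] reval_sim[OF assms(2)] by eventually_elim simp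
  then show ?thesis by simp
qed

lemma compute_eq_Some_iff: "compute w f x = Some y \<longleftrightarrow> reval w f [x] y"
  unfolding compute_def using reval_deterministic by (metis option.distinct(1) option.inject the_equality)

section \<open>Total recursive functions\<close>

text \<open>Closure properties of this extensional notion replace explicit programs. Only argument
  lists of length \<open>n\<close> matter; elsewhere \<open>F\<close> is arbitrary.\<close>

definition total_rec :: "nat \<Rightarrow> (nat list \<Rightarrow> nat) \<Rightarrow> bool" where
  "total_rec n F \<longleftrightarrow>
     (\<exists>g. oracle_free g \<and> (\<forall>xs. length xs = n \<longrightarrow> reval (\<lambda>_. False) g xs (F xs)))"

abbreviation total_pred :: "nat \<Rightarrow> (nat list \<Rightarrow> bool) \<Rightarrow> bool" where
  "total_pred n P \<equiv> total_rec n (\<lambda>xs. of_bool (P xs))"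

section \<open>Closure under composition, primitive recursion and arithmetic\<close>

lemma total_rec_cong:
  assumes "total_rec n F" "\<And>xs. length xs = n \<Longrightarrow> G xs = F xs"
  shows "total_rec n G"
  using assms unfolding total_rec_def by metis

lemma total_rec_comp:
  assumes "total_rec (length Fs) G" "\<And>F. F \<in> set Fs \<Longrightarrow> total_rec n F"
  shows "total_rec n (\<lambda>xs. G (map (\<lambda>F. F xs) Fs))"
proof -
  obtain g where g: "oracle_free g" "\<And>xs. length xs = length Fs \<Longrightarrow> reval (\<lambda>_. False) g xs (G xs)"
    using assms(1) unfolding total_rec_def by blast
  have "\<forall>F\<in>set Fs. \<exists>h. oracle_free h \<and> (\<forall>xs. length xs = n \<longrightarrow> reval (\<lambda>_. False) h xs (F xs))"
    using assms(2) unfolding total_rec_def by blast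
  then obtain h where h: "\<And>F. F \<in> set Fs \<Longrightarrow> oracle_free (h F)"
    "\<And>F xs. F \<in> set Fs \<Longrightarrow> length xs = n \<Longrightarrow> reval (\<lambda>_. False) (h F) xs (F xs)"
    by metis
  show ?thesis
    unfolding total_rec_def
  proof (intro exI[of _ "Comp g (map h Fs)"] conjI allI impI)
    show "oracle_free (Comp g (map h Fs))" using g h by auto
    fix xs :: "nat list" assume "length xs = n"
    then show "reval (\<lambda>_. False) (Comp g (map h Fs)) xs (G (map (\<lambda>F. F xs) Fs))"
      using g(2) h(2) by (intro reval.intros(4)[where ys = "map (\<lambda>F. F xs) Fs"])
        (auto simp: list_all2_map1 list_all2_map2 intro!: list.rel_refl_strong)
  qed
qed

lemma total_rec_subst:
  assumes "total_rec m G" "length Fs = m" "\<And>F. F \<in> set Fs \<Longrightarrow> total_rec n F"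
    "\<And>xs. length xs = n \<Longrightarrow> H xs = G (map (\<lambda>F. F xs) Fs)"
  shows "total_rec n H"
  using total_rec_comp[of Fs G n] assms by (auto intro: total_rec_cong)

lemma total_rec_nth: "i < n \<Longrightarrow> total_rec n (\<lambda>xs. xs ! i)"
  unfolding total_rec_def by (intro exI[of _ "Proj i"]) (auto intro: reval.intros(3))

lemma total_rec_0: "total_rec n (\<lambda>_. 0)"
  unfolding total_rec_def by (intro exI[of _ Zero]) (auto intro: reval.intros(1))

lemma total_rec_app1:
  assumes "total_rec 1 (\<lambda>xs. h (xs ! 0))" "total_rec n A"
  shows "total_rec n (\<lambda>xs. h (A xs))"
  by (rule total_rec_subst[OF assms(1), of "[A]"]) (use assms in auto)

lemma total_rec_app2:
  assumes "total_rec 2 (\<lambda>xs. h (xs ! 0) (xs ! 1))" "total_rec n A" "total_rec n B"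
  shows "total_rec n (\<lambda>xs. h (A xs) (B xs))"
  by (rule total_rec_subst[OF assms(1), of "[A, B]"]) (use assms in auto)

lemma total_rec_app3:
  assumes "total_rec 3 (\<lambda>xs. h (xs ! 0) (xs ! 1) (xs ! 2))"
    "total_rec n A" "total_rec n B" "total_rec n D"
  shows "total_rec n (\<lambda>xs. h (A xs) (B xs) (D xs))"
  by (rule total_rec_subst[OF assms(1), of "[A, B, D]"]) (use assms in auto)

lemma total_rec_Suc:
  assumes "total_rec n A"
  shows "total_rec n (\<lambda>xs. Suc (A xs))"
proof (rule total_rec_app1[where h = Suc, OF _ assms])
  have "reval (\<lambda>_. False) Succ xs (Suc (xs ! 0))" if "length xs = 1" for xs
    using that reval.intros(2)[of _ xs] by (cases xs) (auto simp: arg0_def)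
  then show "total_rec 1 (\<lambda>xs. Suc (xs ! 0))"
    unfolding total_rec_def by (intro exI[of _ Succ]) auto
qed

lemma total_rec_const: "total_rec n (\<lambda>_. c)"
  by (induction c) (simp_all add: total_rec_0 total_rec_Suc)

lemma total_rec_rec_nat:
  assumes "total_rec n F" "total_rec (Suc (Suc n)) G"
  shows "total_rec (Suc n) (\<lambda>ys. rec_nat (F (tl ys)) (\<lambda>i y. G (y # i # tl ys)) (hd ys))"
proof -
  obtain f where f: "oracle_free f" "\<And>xs. length xs = n \<Longrightarrow> reval (\<lambda>_. False) f xs (F xs)"
    using assms(1) unfolding total_rec_def by blast
  obtain g where g: "oracle_free g"
    "\<And>xs. length xs = Suc (Suc n) \<Longrightarrow> reval (\<lambda>_. False) g xs (G xs)"
    using assms(2) unfolding total_rec_def by blast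
  have "reval (\<lambda>_. False) (Prim f g) (m # xs) (rec_nat (F xs) (\<lambda>i y. G (y # i # xs)) m)"
    if "length xs = n" for m xs
    using that
  proof (induction m)
    case (Suc m)
    then show ?case using reval.intros(6)[OF Suc.IH[OF Suc.prems] g(2)] by simp
  qed (auto intro: reval.intros(5) f)
  then show ?thesis
    unfolding total_rec_def using f(1) g(1)
    by (intro exI[of _ "Prim f g"]) (auto simp: length_Suc_conv)
qed

lemma map_nth_upt_drop: "length zs = N \<Longrightarrow> map ((!) zs) [k..<N] = drop k zs"
  by (intro nth_equalityI) auto

lemma total_rec_rec_nat_bound:
  assumes "total_rec n F" "total_rec (Suc (Suc n)) G" "total_rec n B"
  shows "total_rec n (\<lambda>xs. rec_nat (F xs) (\<lambda>i y. G (y # i # xs)) (B xs))"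
proof (rule total_rec_subst[OF total_rec_rec_nat[OF assms(1,2)]])
  let ?Fs = "B # map (\<lambda>i zs. zs ! i) [0..<n]"
  show "length ?Fs = Suc n" by simp
  show "total_rec n F'" if "F' \<in> set ?Fs" for F'
    using that assms(3) total_rec_nth by auto
  fix xs :: "nat list" assume "length xs = n"
  then show "rec_nat (F xs) (\<lambda>i y. G (y # i # xs)) (B xs) =
    rec_nat (F (tl (map (\<lambda>F. F xs) ?Fs)))
      (\<lambda>i y. G (y # i # tl (map (\<lambda>F. F xs) ?Fs))) (hd (map (\<lambda>F. F xs) ?Fs))"
    by (simp add: o_def map_nth_upt_drop)
qed

lemma total_rec_add:
  assumes "total_rec n A" "total_rec n B"
  shows "total_rec n (\<lambda>xs. A xs + B xs)"
proof (rule total_rec_app2[where h = "(+)", OF _ assms])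
  have "rec_nat b (\<lambda>i. Suc) a = a + b" for a b by (induction a) auto
  then show "total_rec 2 (\<lambda>xs. xs ! 0 + xs ! 1)"
    using total_rec_rec_nat_bound[of 2 "\<lambda>xs. xs ! 1" "\<lambda>xs. Suc (xs ! 0)" "\<lambda>xs. xs ! 0"]
    by (simp add: total_rec_nth total_rec_Suc)
qed

lemma total_rec_diff:
  assumes "total_rec n A" "total_rec n B"
  shows "total_rec n (\<lambda>xs. A xs - B xs)"
proof (rule total_rec_app2[where h = "(-)", OF _ assms])
  have "rec_nat 0 (\<lambda>i y. i) a = a - 1" for a by (cases a) auto
  then have "total_rec 1 (\<lambda>xs. xs ! 0 - 1)"
    using total_rec_rec_nat_bound[of 1 "\<lambda>xs. 0" "\<lambda>xs. xs ! 1" "\<lambda>xs. xs ! 0"]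
    by (simp add: total_rec_nth total_rec_0)
  then have pred: "total_rec n (\<lambda>xs. A xs - 1)" if "total_rec n A" for n A
    using that by (rule total_rec_app1)
  have "rec_nat a (\<lambda>i y. y - 1) b = a - b" for a b by (induction b) auto
  then show "total_rec 2 (\<lambda>xs. xs ! 0 - xs ! 1)"
    using total_rec_rec_nat_bound[OF total_rec_nth pred[OF total_rec_nth] total_rec_nth, of 0 2 0 1]
    by simp
qed

lemma total_rec_sum:
  assumes "total_rec (Suc n) F" "total_rec n B"
  shows "total_rec n (\<lambda>xs. \<Sum>i<B xs. F (i # xs))"
proof -
  have "rec_nat 0 (\<lambda>i y. y + F (i # xs)) m = (\<Sum>i<m. F (i # xs))" for m xs
    by (induction m) auto
  moreover have "total_rec (Suc (Suc n)) (\<lambda>xs. xs ! 0 + F (tl xs))"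
  proof (intro total_rec_add total_rec_nth)
    show "total_rec (Suc (Suc n)) (\<lambda>xs. F (tl xs))"
      by (rule total_rec_subst[OF assms(1), of "map (\<lambda>i zs. zs ! i) [1..<Suc (Suc n)]"])
        (auto simp: o_def map_nth_upt_drop drop_Suc total_rec_nth simp del: upt_Suc)
  qed simp
  ultimately show ?thesis
    using total_rec_rec_nat_bound[OF total_rec_0 _ assms(2), of "\<lambda>xs. xs ! 0 + F (tl xs)"] by simp
qed

lemma total_rec_mult:
  assumes "total_rec n A" "total_rec n B"
  shows "total_rec n (\<lambda>xs. A xs * B xs)"
proof (rule total_rec_app2[where h = "(*)", OF _ assms])
  show "total_rec 2 (\<lambda>xs. xs ! 0 * xs ! 1)"
    using total_rec_sum[of 2 "\<lambda>xs. xs ! 2" "\<lambda>xs. xs ! 0"] by (simp add: total_rec_nth)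
qed

lemma total_rec_power:
  assumes "total_rec n A" "total_rec n B"
  shows "total_rec n (\<lambda>xs. A xs ^ B xs)"
proof (rule total_rec_app2[where h = "(^)", OF _ assms])
  have "rec_nat (Suc 0) (\<lambda>i y. a * y) b = a ^ b" for a b :: nat by (induction b) auto
  then show "total_rec 2 (\<lambda>xs. xs ! 0 ^ xs ! 1)"
    using total_rec_rec_nat_bound[OF total_rec_const total_rec_mult[OF total_rec_nth total_rec_nth]
        total_rec_nth, of 2 2 0 1 "Suc 0"]
    by (simp add: numeral_2_eq_2)
qed

section \<open>Decidable predicates, case distinction and division\<close>

lemma total_pred_le:
  assumes "total_rec n A" "total_rec n B"
  shows "total_pred n (\<lambda>xs. A xs \<le> B xs)"
  by (rule total_rec_cong[of n "\<lambda>xs. 1 - (A xs - B xs)"])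
    (auto intro!: assms total_rec_diff total_rec_const)

lemma total_pred_not: "total_pred n P \<Longrightarrow> total_pred n (\<lambda>xs. \<not> P xs)"
  by (rule total_rec_cong[of n "\<lambda>xs. 1 - of_bool (P xs)"])
    (auto intro!: total_rec_diff total_rec_const)

lemma total_pred_conj: "total_pred n P \<Longrightarrow> total_pred n Q \<Longrightarrow> total_pred n (\<lambda>xs. P xs \<and> Q xs)"
  by (rule total_rec_cong[of n "\<lambda>xs. of_bool (P xs) * of_bool (Q xs)"])
    (auto intro!: total_rec_mult)

lemma total_pred_disj: "total_pred n P \<Longrightarrow> total_pred n Q \<Longrightarrow> total_pred n (\<lambda>xs. P xs \<or> Q xs)"
  using total_pred_not[OF total_pred_conj[OF total_pred_not total_pred_not], of n P Q] by simp

lemma total_pred_less: "total_rec n A \<Longrightarrow> total_rec n B \<Longrightarrow> total_pred n (\<lambda>xs. A xs < B xs)"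
  using total_pred_le[of n "\<lambda>xs. Suc (A xs)" B] by (simp add: total_rec_Suc Suc_le_eq)

lemma total_pred_eq: "total_rec n A \<Longrightarrow> total_rec n B \<Longrightarrow> total_pred n (\<lambda>xs. A xs = B xs)"
  using total_pred_conj[OF total_pred_le total_pred_le, of n A B B A] by (simp add: eq_iff)

lemma total_rec_if:
  assumes "total_pred n P" "total_rec n A" "total_rec n B"
  shows "total_rec n (\<lambda>xs. if P xs then A xs else B xs)"
  by (rule total_rec_cong[of n "\<lambda>xs. of_bool (P xs) * A xs + (1 - of_bool (P xs)) * B xs"])
    (auto intro!: assms total_rec_mult total_rec_add total_rec_diff total_rec_const)

lemma total_pred_ball:
  assumes "total_pred (Suc n) P" "total_rec n B"
  shows "total_pred n (\<lambda>xs. \<forall>i<B xs. P (i # xs))"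
  by (rule total_rec_cong[of n "\<lambda>xs. of_bool ((\<Sum>i<B xs. of_bool (\<not> P (i # xs))) = (0::nat))"])
    (intro total_pred_eq total_rec_0 total_rec_sum total_pred_not assms, auto)

lemma sum_of_bool_lessThan: "(\<Sum>i<n. of_bool (P i)) = card {i. i < n \<and> P i}" for n :: nat
proof -
  have "{..<n} \<inter> {i. P i} = {i. i < n \<and> P i}" by auto
  then show ?thesis by simp
qed

text \<open>The quotient \<open>a div b\<close> counts the \<open>i < a\<close> with
  \<open>Suc i * b \<le> a\<close>, which makes division a bounded sum.\<close>

lemma total_rec_div:
  assumes "total_rec n A" "total_rec n B" "\<And>xs. length xs = n \<Longrightarrow> B xs > 0"
  shows "total_rec n (\<lambda>xs. A xs div B xs)"
proof -
  have 1: "(\<Sum>i<a. of_bool (Suc i * b \<le> a)) = a div b" if "b > 0" for a b :: nat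
  proof -
    have "{i. i < a \<and> Suc i * b \<le> a} = {..<a div b}"
      using that div_le_dividend[of a b]
      by (auto simp: less_eq_div_iff_mult_less_eq[symmetric] Suc_le_eq simp del: mult_Suc div_le_dividend)
    then show ?thesis by (simp add: sum_of_bool_lessThan del: mult_Suc)
  qed
  have "total_rec 2 (\<lambda>xs. \<Sum>i<xs ! 0. of_bool (Suc i * xs ! 1 \<le> xs ! 0))"
    using total_rec_sum[of 2 "\<lambda>xs. of_bool (Suc (xs ! 0) * xs ! 2 \<le> xs ! 1)" "\<lambda>xs. xs ! 0"]
    by (simp add: total_pred_le total_rec_nth total_rec_mult total_rec_Suc del: mult_Suc)
  then have "total_rec n (\<lambda>xs. \<Sum>i<A xs. of_bool (Suc i * B xs \<le> A xs))"
    by (rule total_rec_app2[where h = "\<lambda>a b. \<Sum>i<a. of_bool (Suc i * b \<le> a)", OF _ assms(1,2)])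
  then show ?thesis by (rule total_rec_cong) (simp only: 1 assms(3))
qed

lemma total_pred_odd:
  assumes "total_rec n A"
  shows "total_pred n (\<lambda>xs. odd (A xs))"
  by (rule total_rec_cong[of n "\<lambda>xs. A xs - 2 * (A xs div 2)"])
    (intro assms total_rec_diff total_rec_mult total_rec_div total_rec_const,
      simp_all add: minus_mult_div_eq_mod odd_iff_mod_2_eq_one)

lemmas total_rec_intros = total_rec_nth total_rec_const total_rec_Suc total_rec_add total_rec_diff
  total_rec_mult total_rec_power total_pred_le total_pred_less total_pred_eq total_pred_not
  total_pred_conj total_pred_disj total_rec_if total_pred_odd

text \<open>The program is fixed while bound, oracle piece and arguments vary, so the proof is by
  induction on the program. Since the oracle piece is passed as a number, even a program with
  \<open>Orc\<close> is evaluated without an oracle.\<close>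

lemma total_rec_sim: "total_rec (Suc (Suc n)) (\<lambda>zs. sim (zs ! 0) (zs ! 1) f (drop 2 zs))"
proof (induction f arbitrary: n)
  case Zero
  show ?case by (simp add: total_rec_const)
next
  case Succ
  show ?case
  proof (cases n)
    case 0
    then show ?thesis
      by (intro total_rec_cong[OF total_rec_const[of _ 2]]) (auto simp: arg0_def)
  next
    case (Suc m)
    then show ?thesis
      by (intro total_rec_cong[OF total_rec_Suc[OF total_rec_Suc[OF total_rec_nth[of 2]]]])
        (auto simp: arg0_def hd_drop_conv_nth)
  qed
next
  case (Proj i)
  show ?case
  proof (cases "i < n")
    case True
    then show ?thesis
      by (intro total_rec_cong[OF total_rec_Suc[OF total_rec_nth[of "i + 2"]]]) auto
  next
    case False
    then show ?thesis by (intro total_rec_cong[OF total_rec_0]) auto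
  qed
next
  case (Comp f gs)
  have all: "total_pred (Suc (Suc n)) (\<lambda>zs. \<forall>g\<in>set gs'. sim (zs ! 0) (zs ! 1) g (drop 2 zs) \<noteq> 0)"
    if "set gs' \<subseteq> set gs" for gs'
    using that
  proof (induction gs')
    case Nil
    then show ?case by (simp add: total_rec_const)
  next
    case (Cons g gs')
    then show ?case
      using total_pred_conj[OF total_pred_not[OF total_pred_eq[OF Comp.IH(2) total_rec_0]], of g n]
      by simp
  qed
  have "total_rec (Suc (Suc n)) (\<lambda>zs. sim (zs ! 0) (zs ! 1) f
      (map (\<lambda>g. sim (zs ! 0) (zs ! 1) g (drop 2 zs) - 1) gs))"
    by (rule total_rec_subst[OF Comp.IH(1)[of "length gs"], of
          "(\<lambda>zs. zs ! 0) # (\<lambda>zs. zs ! 1) # map (\<lambda>g zs. sim (zs ! 0) (zs ! 1) g (drop 2 zs) - 1) gs"])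
      (auto simp: o_def intro!: total_rec_intros Comp.IH(2) simp del: One_nat_def)
  then have "total_rec (Suc (Suc n)) (\<lambda>zs.
      if \<forall>g\<in>set gs. sim (zs ! 0) (zs ! 1) g (drop 2 zs) \<noteq> 0 then sim (zs ! 0) (zs ! 1) f
      (map (\<lambda>g. sim (zs ! 0) (zs ! 1) g (drop 2 zs) - 1) gs) else 0)"
    by (intro total_rec_if total_rec_0 all) auto
  then show ?case by (simp only: sim.simps)
next
  case (Prim f g)
  show ?case
  proof (cases n)
    case 0
    then show ?thesis by (intro total_rec_cong[OF total_rec_0]) auto
  next
    case (Suc m)
    let ?N = "Suc (Suc (Suc m))"
    let ?rest = "map (\<lambda>i zs. zs ! i)"
    \<comment> \<open>Here \<open>us\<close> is \<open>y # i # s # a # h # xs\<close>: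
      \<open>us ! 0 - 1\<close> removes the \<open>Suc\<close> from a finished previous value, and
      \<open>drop 5\<close> also skips the recursion argument \<open>h\<close>.\<close>
    let ?G = "\<lambda>us. sim (us ! 2) (us ! 3) g ((us ! 0 - 1) # us ! 1 # drop 5 us)"
    have G: "total_rec (Suc (Suc ?N)) ?G"
      by (rule total_rec_subst[OF Prim.IH(2)[of "Suc (Suc m)"], of
          "(\<lambda>us. us ! 2) # (\<lambda>us. us ! 3) # (\<lambda>us. us ! 0 - 1) # (\<lambda>us. us ! 1) # ?rest [5..<Suc (Suc ?N)]"])
        (auto simp: o_def map_nth_upt_drop intro!: total_rec_intros simp del: upt_Suc One_nat_def)
    have F: "total_rec ?N (\<lambda>zs. sim (zs ! 0) (zs ! 1) f (drop 3 zs))"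
      by (rule total_rec_subst[OF Prim.IH(1)[of m], of
            "(\<lambda>us. us ! 0) # (\<lambda>us. us ! 1) # ?rest [3..<?N]"])
        (auto simp: o_def map_nth_upt_drop intro!: total_rec_intros simp del: upt_Suc One_nat_def)
    have "total_rec ?N (\<lambda>zs. rec_nat (sim (zs ! 0) (zs ! 1) f (drop 3 zs))
        (\<lambda>i y. if (y # i # zs) ! 0 = 0 then 0 else ?G (y # i # zs)) (zs ! 2))"
      by (intro total_rec_rec_nat_bound total_rec_intros F G) auto
    moreover have "sim (zs ! 0) (zs ! 1) (Prim f g) (drop 2 zs) =
        rec_nat (sim (zs ! 0) (zs ! 1) f (drop 3 zs))
        (\<lambda>i y. if (y # i # zs) ! 0 = 0 then 0 else ?G (y # i # zs)) (zs ! 2)"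
      if "length zs = ?N" for zs
    proof -
      from that obtain s a h xs where zs: "zs = s # a # h # xs"
        by (metis length_Suc_conv)
      have "(\<lambda>i y. if (y # i # zs) ! 0 = 0 then 0 else ?G (y # i # zs)) =
          (\<lambda>i y. case y of 0 \<Rightarrow> 0 | Suc v \<Rightarrow> sim s a g (v # i # xs))"
        by (auto simp: fun_eq_iff zs split: nat.split)
      then show ?thesis by (simp add: zs sim.simps(5))
    qed
    ultimately show ?thesis unfolding Suc by (rule total_rec_cong)
  qed
next
  case (Mu f)
  let ?rest = "map (\<lambda>i zs. zs ! i)"
  \<comment> \<open>Here \<open>us\<close> is \<open>n # s # a # xs\<close> with the candidate
    \<open>n\<close> in front. In \<open>F'\<close> the bounded variable \<open>m\<close> precedes
    it, and \<open>us ! 0\<close> is \<open>m\<close>.\<close>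
  have F: "total_rec (Suc (Suc (Suc n))) (\<lambda>us. sim (us ! 1) (us ! 2) f (us ! 0 # drop 3 us))"
    by (rule total_rec_subst[OF Mu.IH[of "Suc n"], of
        "(\<lambda>us. us ! 1) # (\<lambda>us. us ! 2) # (\<lambda>us. us ! 0) # ?rest [3..<Suc (Suc (Suc n))]"])
      (auto simp: o_def map_nth_upt_drop intro!: total_rec_intros simp del: upt_Suc One_nat_def)
  have F': "total_rec (Suc (Suc (Suc (Suc n)))) (\<lambda>us. sim (us ! 2) (us ! 3) f (us ! 0 # drop 4 us))"
    by (rule total_rec_subst[OF Mu.IH[of "Suc n"], of
        "(\<lambda>us. us ! 2) # (\<lambda>us. us ! 3) # (\<lambda>us. us ! 0) # ?rest [4..<Suc (Suc (Suc (Suc n)))]"])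
      (auto simp: o_def map_nth_upt_drop intro!: total_rec_intros simp del: upt_Suc One_nat_def)
  let ?P = "\<lambda>us. sim (us ! 1) (us ! 2) f (us ! 0 # drop 3 us) = Suc 0 \<and>
     (\<forall>m<us ! 0. Suc 0 < sim ((m # us) ! 2) ((m # us) ! 3) f ((m # us) ! 0 # drop 4 (m # us)))"
  have "total_pred (Suc (Suc (Suc n))) ?P"
    by (intro total_pred_conj total_pred_eq total_pred_less F F' total_rec_intros
        total_pred_ball[where P = "\<lambda>us. Suc 0 < sim (us ! 2) (us ! 3) f (us ! 0 # drop 4 us)"]) auto
  then have "total_rec (Suc (Suc (Suc n))) (\<lambda>us. if ?P us then Suc (us ! 0) else 0)"
    by (rule total_rec_if[OF _ total_rec_Suc[OF total_rec_nth] total_rec_0]) simp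
  from total_rec_sum[OF this total_rec_nth[of 0]] show ?case
    by (simp add: eval_nat_numeral cong: if_cong)
next
  case Orc
  show ?case
  proof (cases n)
    case 0
    have "total_rec (Suc (Suc n))
        (\<lambda>zs. if 0 < zs ! 0 then Suc (of_bool (odd (zs ! 1))) else 0)"
      by (intro total_rec_intros) auto
    with 0 show ?thesis by (elim total_rec_cong) (auto simp: arg0_def)
  next
    case (Suc m)
    have "total_rec (Suc (Suc n))
        (\<lambda>zs. if zs ! 2 < zs ! 0 then Suc (of_bool (odd (zs ! 1 div 2 ^ (zs ! 2)))) else 0)"
      by (intro total_rec_intros total_rec_div) (auto simp: Suc)
    with Suc show ?thesis by (elim total_rec_cong) (auto simp: arg0_def hd_drop_conv_nth)
  qed
qed

text \<open>\<open>Mu\<close> searches for a zero, so it is applied to the characteristic function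
  of the negation. That function is total, hence the search passes every smaller candidate and stops
  at the first witness.\<close>

lemma total_rec_Least:
  assumes "total_pred (Suc n) P"
  obtains g where "oracle_free g"
    "\<And>xs s. length xs = n \<Longrightarrow> P (s # xs) \<Longrightarrow> reval (\<lambda>_. False) g xs (LEAST s. P (s # xs))"
proof -
  obtain g where g: "oracle_free g"
    "\<And>xs. length xs = Suc n \<Longrightarrow> reval (\<lambda>_. False) g xs (of_bool (\<not> P xs))"
    using total_pred_not[OF assms] unfolding total_rec_def by blast
  show thesis
  proof
    show "oracle_free (Mu g)" using g(1) by simp
    fix xs s assume xs: "length xs = n" and s: "P (s # xs)"
    let ?s = "LEAST s. P (s # xs)"
    have "P (?s # xs)" using s by (rule LeastI)
    then have "reval (\<lambda>_. False) g (?s # xs) 0" using g(2)[of "?s # xs"] xs by simp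
    moreover have "reval (\<lambda>_. False) g (m # xs) 1" if "m < ?s" for m
      using g(2)[of "m # xs"] xs not_less_Least[OF that] by simp
    then have "\<forall>m<?s. \<exists>y. reval (\<lambda>_. False) g (m # xs) y \<and> y \<noteq> 0"
      using one_neq_zero by blast
    ultimately show "reval (\<lambda>_. False) (Mu g) xs ?s" by (rule reval.intros(7))
  qed
qed

section \<open>Strings and machines\<close>

lemma str_to_nat_inject: "str_to_nat x = str_to_nat y \<Longrightarrow> x = y"
proof (induction x arbitrary: y)
  case Nil
  then show ?case by (cases y) (auto split: if_splits)
next
  case (Cons a x)
  then obtain b y' where y: "y = b # y'" by (cases y) (auto split: if_splits)
  have "2 * str_to_nat x + (if a then 2 else 1) = 2 * str_to_nat y' + (if b then 2 else 1)"
    using Cons.prems y by simp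
  then have "a = b \<and> str_to_nat x = str_to_nat y'" by (cases a; cases b; simp; presburger)
  then show ?case using Cons.IH y by blast
qed

lemma str_to_nat_surj: "\<exists>x. str_to_nat x = n"
proof (induction n rule: less_induct)
  case (less n)
  consider "n = 0" | m where "n = 2 * m + 1" | m where "n = 2 * m + 2"
    by atomize_elim presburger
  then show ?case
  proof cases
    case 1
    then show ?thesis by (intro exI[of _ "[]"]) simp
  next
    case (2 m)
    then obtain x where "str_to_nat x = m" using less[of m] by auto
    with 2 show ?thesis by (intro exI[of _ "False # x"]) simp
  next
    case (3 m)
    then obtain x where "str_to_nat x = m" using less[of m] by auto
    with 3 show ?thesis by (intro exI[of _ "True # x"]) simp
  qed
qed

lemma inj_str_to_nat: "inj str_to_nat"
  by (simp add: inj_def str_to_nat_inject)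

lemma nat_to_str_inverse [simp]: "nat_to_str (str_to_nat x) = x"
  unfolding nat_to_str_def by (rule inv_f_f[OF inj_str_to_nat])

lemma str_to_nat_inverse [simp]: "str_to_nat (nat_to_str n) = n"
  using str_to_nat_surj[of n] by auto

lemma nat_to_str_eq_iff: "nat_to_str n = x \<longleftrightarrow> n = str_to_nat x"
  by auto

text \<open>The strings of length \<open>l\<close> occupy exactly the numbers from
  \<open>2 ^ l - 1\<close> to \<open>2 ^ (l + 1) - 2\<close>.\<close>

lemma str_to_nat_bounds: "2 ^ length x \<le> str_to_nat x + 1 \<and> str_to_nat x + 1 < 2 ^ Suc (length x)"
  by (induction x) auto

lemma length_le_iff: "length x \<le> n \<longleftrightarrow> str_to_nat x < 2 ^ Suc n - 1"
proof
  assume "length x \<le> n"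
  then have "(2::nat) ^ Suc (length x) \<le> 2 ^ Suc n" by (intro power_increasing) auto
  then show "str_to_nat x < 2 ^ Suc n - 1" using str_to_nat_bounds[of x] by linarith
next
  assume "str_to_nat x < 2 ^ Suc n - 1"
  then have "2 ^ length x < (2::nat) ^ Suc n" using str_to_nat_bounds[of x] by linarith
  then show "length x \<le> n" by (simp del: power_Suc)
qed

lemma length_nat_to_str_eqI:
  assumes "2 ^ k \<le> Suc r" "Suc r < 2 ^ Suc k"
  shows "length (nat_to_str r) = k"
proof -
  have "2 ^ k < (2::nat) ^ Suc (length (nat_to_str r))" "2 ^ length (nat_to_str r) < (2::nat) ^ Suc k"
    using assms str_to_nat_bounds[of "nat_to_str r"] by simp_all
  then show ?thesis by (simp del: power_Suc)
qed

text \<open>Counts of strings become bounded sums over numbers, the form in which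
  \<open>stage\<close> can be decided by a recursive function.\<close>

lemma card_strings_eq_sum:
  "card {x. length x \<le> n \<and> P (str_to_nat x)} = (\<Sum>i<2 ^ Suc n - 1. of_bool (P i))"
proof -
  have "str_to_nat ` {x. length x \<le> n \<and> P (str_to_nat x)} = {i. i < 2 ^ Suc n - 1 \<and> P i}"
  proof (intro equalityI subsetI)
    fix i assume "i \<in> {i. i < 2 ^ Suc n - 1 \<and> P i}"
    then show "i \<in> str_to_nat ` {x. length x \<le> n \<and> P (str_to_nat x)}"
      by (intro image_eqI[of _ _ "nat_to_str i"]) (auto simp: length_le_iff)
  qed (auto simp: length_le_iff)
  moreover have "inj_on str_to_nat {x. length x \<le> n \<and> P (str_to_nat x)}"
    by (rule inj_on_subset[OF inj_str_to_nat subset_UNIV])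
  ultimately show ?thesis by (simp only: sum_of_bool_lessThan card_image[symmetric])
qed

lemma card_strings: "card {x::bool list. length x \<le> n} = 2 ^ Suc n - 1"
  using card_strings_eq_sum[of n "\<lambda>_. True"] by simp

lemma finite_strings: "finite {x::bool list. length x \<le> n}"
proof (rule card_ge_0_finite)
  have "1 < (2::nat) ^ Suc n" by (rule one_less_power) auto
  then show "0 < card {x::bool list. length x \<le> n}" unfolding card_strings by linarith
qed

lemma total_rec_length:
  assumes "total_rec n A"
  shows "total_rec n (\<lambda>xs. length (nat_to_str (A xs)))"
proof (rule total_rec_app1[where h = "\<lambda>p. length (nat_to_str p)", OF _ assms])
  \<comment> \<open>The length is the integer part of the binary logarithm of \<open>p + 1\<close>.
    The bound \<open>i < p\<close> cuts nothing off, since \<open>Suc i < 2 ^ Suc i\<close>.\<close>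
  have "(\<Sum>i<p. of_bool (2 ^ Suc i \<le> Suc p)) = length (nat_to_str p)" for p :: nat
  proof -
    let ?l = "length (nat_to_str p)"
    have b: "2 ^ ?l \<le> Suc p" "Suc p < 2 ^ Suc ?l"
      using str_to_nat_bounds[of "nat_to_str p"] by simp_all
    have "{i. i < p \<and> 2 ^ Suc i \<le> Suc p} = {..<?l}"
    proof (intro equalityI subsetI)
      fix i assume "i \<in> {i. i < p \<and> 2 ^ Suc i \<le> Suc p}"
      then have "2 ^ Suc i \<le> Suc p" by blast
      then have "(2::nat) ^ Suc i < 2 ^ Suc ?l" using b(2) by (rule le_less_trans)
      then show "i \<in> {..<?l}" by (simp del: power_Suc)
    next
      fix i assume "i \<in> {..<?l}"
      then have "(2::nat) ^ Suc i \<le> 2 ^ ?l" by (intro power_increasing) auto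
      then have "2 ^ Suc i \<le> Suc p" using b(1) by (rule order_trans)
      moreover from this have "Suc i < Suc p" by (rule less_le_trans[OF less_exp])
      ultimately show "i \<in> {i. i < p \<and> 2 ^ Suc i \<le> Suc p}" by (simp del: power_Suc)
    qed
    then show ?thesis by (simp add: sum_of_bool_lessThan del: power_Suc)
  qed
  moreover have "total_rec 1 (\<lambda>xs. \<Sum>i<xs ! 0. of_bool (2 ^ Suc ((i # xs) ! 0) \<le> Suc ((i # xs) ! 1)))"
    by (intro total_rec_sum[where F = "\<lambda>xs. of_bool (2 ^ Suc (xs ! 0) \<le> Suc (xs ! 1))"]
        total_rec_intros) auto
  ultimately show "total_rec 1 (\<lambda>xs. length (nat_to_str (xs ! 0)))" by simp
qed

section \<open>Machines, optimality and programs with large output\<close>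

lemma machineI:
  assumes "oracle_free f"
  shows "machine (\<lambda>p. map_option nat_to_str (compute (\<lambda>_. False) f (str_to_nat p)))"
  using assms unfolding machine_def by blast

lemma machineE:
  assumes "machine V"
  obtains f where "oracle_free f"
    "\<And>p x. V p = Some x \<longleftrightarrow> reval (\<lambda>_. False) f [str_to_nat p] (str_to_nat x)"
proof -
  from assms obtain f where f: "oracle_free f"
    "\<And>p. V p = map_option nat_to_str (compute (\<lambda>_. False) f (str_to_nat p))"
    unfolding machine_def by blast
  have "V p = Some x \<longleftrightarrow> reval (\<lambda>_. False) f [str_to_nat p] (str_to_nat x)" for p x
    by (auto simp: f(2) compute_eq_Some_iff[symmetric] nat_to_str_eq_iff)
  with f(1) show thesis using that by blast
qed

text \<open>The complexity inequality is unpacked into an actual program: the output has finite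
  complexity with respect to \<open>U\<close>, so the least length is attained by some
  \<open>q\<close>.\<close>

lemma optimal_simulates:
  assumes "optimal U" "oracle_free f"
  obtains c where "\<And>p y. reval (\<lambda>_. False) f [str_to_nat p] y \<Longrightarrow>
    \<exists>q. U q = Some (nat_to_str y) \<and> length q \<le> length p + c"
proof -
  let ?V = "\<lambda>p. map_option nat_to_str (compute (\<lambda>_. False) f (str_to_nat p))"
  obtain c where c: "\<And>x. C U x \<le> C ?V x + enat c"
    using assms machineI unfolding optimal_def by blast
  show thesis
  proof
    fix p y assume "reval (\<lambda>_. False) f [str_to_nat p] y"
    then have Vp: "?V p = Some (nat_to_str y)" by (auto simp: compute_eq_Some_iff)
    let ?x = "nat_to_str y"
    have "C ?V ?x \<le> enat (length p)"
      using Vp unfolding C_def by (auto intro!: Least_le)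
    then have le: "C U ?x \<le> enat (length p + c)"
      using c[of ?x] by (metis add_right_mono order_trans plus_enat_simps(1))
    then have ex: "\<exists>l q. U q = Some ?x \<and> length q = l"
      unfolding C_def by (auto split: if_splits)
    then have "(LEAST l. \<exists>q. U q = Some ?x \<and> length q = l) \<le> length p + c"
      using le unfolding C_def by (auto split: if_splits)
    moreover have "\<exists>q. U q = Some ?x \<and> length q = (LEAST l. \<exists>q. U q = Some ?x \<and> length q = l)"
      using ex by (rule LeastI_ex)
    ultimately show "\<exists>q. U q = Some ?x \<and> length q \<le> length p + c" by metis
  qed
qed

text \<open>The numerical value of the output plays the part of the halting time.\<close>

definition late :: "(bool list \<Rightarrow> bool list option) \<Rightarrow> nat \<Rightarrow> nat \<Rightarrow> bool list set" where
  "late U n s = {x. length x \<le> n \<and> (\<exists>y. U x = Some y \<and> s < str_to_nat y)}"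

lemma finite_late: "finite (late U n s)"
  unfolding late_def by (rule finite_subset[OF _ finite_strings[of n]]) auto

text \<open>The machine \<open>p \<mapsto> U(q) + p + 1\<close>, where the program \<open>q\<close> is read off from the length of
  \<open>p\<close>, obtains \<open>U(q)\<close> without spending any bits of \<open>p\<close> on it.\<close>
lemma card_late_ge:
  assumes "optimal U"
  obtains c where "\<And>q y. U q = Some y \<Longrightarrow>
    2 ^ str_to_nat q \<le> card (late U (str_to_nat q + c) (str_to_nat y))"
proof -
  obtain u where u: "oracle_free u"
    "\<And>p x. U p = Some x \<longleftrightarrow> reval (\<lambda>_. False) u [str_to_nat p] (str_to_nat x)"
    using assms machineE unfolding optimal_def by blast
  obtain l where l: "oracle_free l"
    "\<And>xs. length xs = 1 \<Longrightarrow> reval (\<lambda>_. False) l xs (length (nat_to_str (xs ! 0)))"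
    using total_rec_length[OF total_rec_nth[of 0 1]] unfolding total_rec_def by auto
  have "total_rec 2 (\<lambda>xs. Suc (xs ! 0 + xs ! 1))" by (intro total_rec_intros) auto
  then obtain a where a: "oracle_free a"
    "\<And>xs. length xs = 2 \<Longrightarrow> reval (\<lambda>_. False) a xs (Suc (xs ! 0 + xs ! 1))"
    unfolding total_rec_def by blast
  let ?f = "Comp a [Comp u [l], Proj 0]"
  have "oracle_free ?f" using u(1) l(1) a(1) by simp
  from optimal_simulates[OF assms this] obtain c where c:
    "\<And>p y. reval (\<lambda>_. False) ?f [str_to_nat p] y \<Longrightarrow>
      \<exists>q. U q = Some (nat_to_str y) \<and> length q \<le> length p + c" by blast
  show thesis
  proof
    fix q y assume q: "U q = Some y"
    let ?m = "str_to_nat q" and ?s = "str_to_nat y"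
    have ex: "\<exists>x. U x = Some (nat_to_str (Suc (?s + r))) \<and> length x \<le> ?m + c"
      if "2 ^ ?m \<le> Suc r" "Suc r < 2 ^ Suc ?m" for r
    proof -
      have len: "length (nat_to_str r) = ?m" using that by (rule length_nat_to_str_eqI)
      then have "reval (\<lambda>_. False) l [r] ?m" using l(2)[of "[r]"] by simp
      then have "reval (\<lambda>_. False) (Comp u [l]) [r] ?s"
        using q u(2) by (intro reval.intros(4)[where ys = "[?m]"]) auto
      then have "reval (\<lambda>_. False) ?f [r] (Suc (?s + r))"
        using a(2)[of "[?s, r]"] reval.intros(3)[of 0 "[r]" "\<lambda>_. False"]
        by (intro reval.intros(4)[where ys = "[?s, r]"]) auto
      then show ?thesis using c[of "nat_to_str r" "Suc (?s + r)"] len by simp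
    qed
    \<comment> \<open>The numbers of the \<open>2 ^ ?m\<close> strings of length \<open>?m\<close>.
      Distinct ones yield distinct outputs \<open>?s + r + 1\<close>, all above \<open>?s\<close>,
      and hence distinct programs.\<close>
    define R where "R = {2 ^ ?m - 1..<2 ^ Suc ?m - (1::nat)}"
    have R: "2 ^ ?m \<le> Suc r \<and> Suc r < 2 ^ Suc ?m" if "r \<in> R" for r
      using that unfolding R_def by auto
    then obtain X where X: "\<And>r. r \<in> R \<Longrightarrow>
        U (X r) = Some (nat_to_str (Suc (?s + r))) \<and> length (X r) \<le> ?m + c"
      using ex by metis
    have "inj_on X R"
    proof (rule inj_onI)
      fix r r' assume "r \<in> R" "r' \<in> R" "X r = X r'"
      then have "nat_to_str (Suc (?s + r)) = nat_to_str (Suc (?s + r'))"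
        using X by (metis option.inject)
      then show "r = r'" by (simp add: nat_to_str_eq_iff)
    qed
    moreover have "X ` R \<subseteq> late U (?m + c) ?s"
      unfolding late_def using X by auto
    ultimately have "card R \<le> card (late U (?m + c) ?s)"
      using finite_late by (intro card_inj_on_le) auto
    then show "2 ^ ?m \<le> card (late U (?m + c) ?s)" by (simp add: R_def)
  qed
qed

section \<open>Stages\<close>

text \<open>A program that is settled at stage \<open>s\<close> but has an output above \<open>s\<close> under \<open>u\<close> is an error
  of \<open>f\<close>.\<close>
definition settled :: "recf \<Rightarrow> recf \<Rightarrow> nat \<Rightarrow> nat \<Rightarrow> nat \<Rightarrow> bool" where
  "settled f u s a x \<longleftrightarrow> sim s a f [x] = 1 \<or>
     (sim s a f [x] = 2 \<and> 0 < sim s 0 u [x] \<and> sim s 0 u [x] \<le> Suc s)"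

text \<open>The fraction of unsettled strings is kept at about \<open>1 / b\<close>, in
  multiplied-out form to stay within the naturals; \<open>2 ^ Suc n - 1\<close> is the number of
  strings of length at most \<open>n\<close>.\<close>

definition stage :: "recf \<Rightarrow> recf \<Rightarrow> nat \<Rightarrow> nat \<Rightarrow> nat \<Rightarrow> nat \<Rightarrow> nat \<Rightarrow> bool" where
  "stage f u b N B s a \<longleftrightarrow>
     (\<forall>n<B. N \<le> n \<longrightarrow> (\<Sum>x<2 ^ Suc n - 1. of_bool (\<not> settled f u s a x)) * b \<le> 2 ^ Suc n)"

lemma total_rec_sim1:
  assumes "total_rec n S" "total_rec n A" "total_rec n X"
  shows "total_rec n (\<lambda>xs. sim (S xs) (A xs) f [X xs])"
proof (rule total_rec_app3[where h = "\<lambda>s a x. sim s a f [x]", OF _ assms])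
  show "total_rec 3 (\<lambda>xs. sim (xs ! 0) (xs ! 1) f [xs ! 2])"
    using total_rec_sim[of "Suc 0" f] unfolding numeral_3_eq_3
    by (rule total_rec_cong) (auto simp: length_Suc_conv)
qed

lemma total_pred_settled:
  assumes "total_rec n S" "total_rec n A" "total_rec n X"
  shows "total_pred n (\<lambda>xs. settled f u (S xs) (A xs) (X xs))"
  unfolding settled_def
  by (intro total_pred_disj total_pred_conj total_pred_eq total_pred_less total_pred_le
      total_rec_sim1 total_rec_Suc total_rec_const assms)

lemma total_pred_stage:
  assumes "total_rec n B" "total_rec n S" "total_rec n A"
  shows "total_pred n (\<lambda>xs. stage f u b N (B xs) (S xs) (A xs))"
proof (rule total_rec_app3[where h = "\<lambda>B s a. of_bool (stage f u b N B s a)", OF _ assms])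
  let ?c = "\<lambda>ys. \<Sum>x<2 ^ Suc (ys ! 0) - 1.
    of_bool (\<not> settled f u ((x # ys) ! 3) ((x # ys) ! 4) ((x # ys) ! 0))"
  have "total_rec 4 ?c"
    by (intro total_rec_sum[where F = "\<lambda>zs. of_bool (\<not> settled f u (zs ! 3) (zs ! 4) (zs ! 0))"]
        total_pred_not total_pred_settled total_rec_intros) auto
  then have "total_pred 4 (\<lambda>ys. \<not> N \<le> ys ! 0 \<or> ?c ys * b \<le> 2 ^ Suc (ys ! 0))"
    by (intro total_pred_disj total_pred_not total_pred_le total_rec_mult total_rec_power
        total_rec_Suc total_rec_nth total_rec_const) auto
  then have "total_pred (Suc 3) (\<lambda>ys. \<not> N \<le> ys ! 0 \<or> ?c ys * b \<le> 2 ^ Suc (ys ! 0))"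
    by simp
  from total_pred_ball[OF this total_rec_nth[of 0]]
  show "total_pred 3 (\<lambda>xs. stage f u b N (xs ! 0) (xs ! 1) (xs ! 2))"
    by (rule total_rec_cong) (auto simp: stage_def)
qed

text \<open>The number \<open>r\<close> encodes a bit string of length \<open>k\<close> and thereby the threshold
  \<open>(r + 1 - 2 ^ k) / 2 ^ k\<close> for the probability of having reached the stage.\<close>
definition enough :: "recf \<Rightarrow> recf \<Rightarrow> nat \<Rightarrow> nat \<Rightarrow> nat \<Rightarrow> nat \<Rightarrow> bool" where
  "enough f u b N r s \<longleftrightarrow> (let k = length (nat_to_str r) in k \<le> s \<and>
     (r + 1 - 2 ^ k) * 2 ^ s \<le>
     (\<Sum>a<2 ^ s. of_bool (stage f u b N (2 ^ (2 * k + 1) + k) s a)) * 2 ^ k)"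

text \<open>Randomness is removed here: the probability at bound \<open>s\<close> is a count over
  all \<open>2 ^ s\<close> oracle pieces, so the first \<open>s\<close> that meets the threshold is
  found by an oracle-free search.\<close>

lemma enough_Least_computable:
  obtains g where "oracle_free g"
    "\<And>r s. enough f u b N r s \<Longrightarrow> reval (\<lambda>_. False) g [r] (LEAST s. enough f u b N r s)"
proof -
  let ?k = "\<lambda>xs. length (nat_to_str (xs ! 1))"
  let ?k' = "\<lambda>xs. length (nat_to_str (xs ! 2))"
  let ?P = "\<lambda>xs. of_bool (stage f u b N (2 ^ (2 * ?k' xs + 1) + ?k' xs) (xs ! 1) (xs ! 0))"
  have "total_rec 2 (\<lambda>xs. \<Sum>a<2 ^ (xs ! 0). ?P (a # xs))"
    by (intro total_rec_sum[where F = ?P] total_pred_stage total_rec_length total_rec_intros) auto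
  then have "total_pred 2 (\<lambda>xs. ?k xs \<le> xs ! 0 \<and>
      (xs ! 1 + 1 - 2 ^ ?k xs) * 2 ^ (xs ! 0) \<le> (\<Sum>a<2 ^ (xs ! 0). ?P (a # xs)) * 2 ^ ?k xs)"
    by (intro total_pred_conj total_pred_le total_rec_mult total_rec_power total_rec_diff
        total_rec_add total_rec_length total_rec_nth total_rec_const) auto
  then have "total_pred (Suc 1) (\<lambda>xs. enough f u b N (xs ! 1) (xs ! 0))"
    unfolding Suc_1 by (rule total_rec_cong) (auto simp: enough_def Let_def)
  then obtain g where g: "oracle_free g" "\<And>xs s. length xs = 1 \<Longrightarrow>
      enough f u b N ((s # xs) ! 1) ((s # xs) ! 0) \<Longrightarrow>
      reval (\<lambda>_. False) g xs (LEAST s. enough f u b N ((s # xs) ! 1) ((s # xs) ! 0))"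
    by (rule total_rec_Least) blast
  show thesis
  proof
    fix r s assume "enough f u b N r s"
    then show "reval (\<lambda>_. False) g [r] (LEAST s. enough f u b N r s)"
      using g(2)[of "[r]" s] by simp
  qed fact
qed

section \<open>Random oracles\<close>

lemma space_coin_space [simp]: "space coin_space = UNIV"
  by (simp add: coin_space_def space_PiM PiE_def extensional_def Pi_def)

interpretation coin: prob_space coin_space
  unfolding coin_space_def by (intro prob_space_PiM measure_pmf.prob_space_axioms)

lemma measurable_coin [measurable]: "(\<lambda>w. w i) \<in> coin_space \<rightarrow>\<^sub>M count_space UNIV"
proof -
  have "(\<lambda>w. w i) \<in> coin_space \<rightarrow>\<^sub>M measure_pmf (bernoulli_pmf (1/2))"
    unfolding coin_space_def by (rule measurable_component_singleton) simp
  then show ?thesis by simp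
qed

lemma measurable_pre [measurable]: "pre s \<in> coin_space \<rightarrow>\<^sub>M count_space UNIV"
proof (rule measurable_count_space_eq2_countable[THEN iffD2], simp_all, intro allI)
  fix a :: nat
  have "{w \<in> space coin_space. \<forall>i<s. w i = odd (a div 2 ^ i)} \<in> sets coin_space"
    by measurable
  moreover have "pre s -` {a} = (if a < 2 ^ s then {w \<in> space coin_space. \<forall>i<s. w i = odd (a div 2 ^ i)} else {})"
    using pre_less[of s] by (cases "a < 2 ^ s") (auto simp: pre_eq_iff[symmetric])
  ultimately show "pre s -` {a} \<in> sets coin_space" by simp
qed

lemma prob_pre_eq:
  assumes "a < 2 ^ s"
  shows "coin.prob {w. pre s w = a} = (1 / 2) ^ s"
proof -
  interpret product_prob_space "\<lambda>_::nat. measure_pmf (bernoulli_pmf (1/2))" UNIV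
    by unfold_locales
  have "coin.prob {w. pre s w = a} =
      coin.prob {w \<in> space coin_space. \<forall>i\<in>{..<s}. w i \<in> {odd (a div 2 ^ i)}}"
    using assms by (simp add: pre_eq_iff Ball_def)
  moreover have "emeasure coin_space {w \<in> space coin_space. \<forall>i\<in>{..<s}. w i \<in> {odd (a div 2 ^ i)}} =
      (\<Prod>i\<in>{..<s}. emeasure (measure_pmf (bernoulli_pmf (1/2))) {odd (a div 2 ^ i)})"
    unfolding coin_space_def by (rule emeasure_PiM_Collect) auto
  moreover have "\<dots> = (\<Prod>i\<in>{..<s}. ennreal (1 / 2))"
    by (intro prod.cong refl) (simp add: emeasure_pmf_single)
  moreover have "\<dots> = ennreal ((1 / 2) ^ s)"
    by (simp add: ennreal_power del: ennreal_half)
  ultimately show ?thesis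
    by (simp add: measure_eq_emeasure_eq_ennreal)
qed

text \<open>Identifies the count in \<open>enough\<close> with a probability: each of the
  \<open>2 ^ s\<close> oracle pieces is equally likely.\<close>

lemma prob_pre:
  "coin.prob {w. P (pre s w)} = real (\<Sum>a<2 ^ s. of_bool (P a)) / 2 ^ s"
proof -
  let ?A = "{a. a < 2 ^ s \<and> P a}"
  have "{w. P (pre s w)} = (\<Union>a\<in>?A. {w. pre s w = a})"
    using pre_less by auto
  also have "coin.prob \<dots> = (\<Sum>a\<in>?A. coin.prob {w. pre s w = a})"
  proof (rule coin.finite_measure_finite_Union)
    have "{w \<in> space coin_space. pre s w = a} \<in> sets coin_space" for a by measurable
    then show "(\<lambda>a. {w. pre s w = a}) ` ?A \<subseteq> sets coin_space" by auto
  qed (auto simp: disjoint_family_on_def)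
  also have "\<dots> = (\<Sum>a\<in>?A. (1 / 2) ^ s)"
    by (intro sum.cong refl prob_pre_eq) simp
  finally show ?thesis
    by (simp only: sum_of_bool_lessThan) (simp add: power_divide)
qed

text \<open>Take \<open>j / 2 ^ k\<close> just below \<open>prob H\<close>. The events
  \<open>X s\<close> eventually exceed this threshold, and one that does so while missing
  \<open>G\<close> would, together with \<open>G\<close>, have more probability than
  \<open>H\<close>.\<close>

lemma (in prob_space) threshold_between:
  assumes X: "\<And>s. X s \<in> events" "\<And>s. X s \<subseteq> H" "\<And>w. w \<in> H \<Longrightarrow> \<forall>\<^sub>F s in sequentially. w \<in> X s"
    and G: "G \<in> events" "G \<subseteq> H" "1 < prob G * 2 ^ k"
  obtains j :: nat where "j < 2 ^ k" "\<exists>s\<ge>k. real j \<le> prob (X s) * 2 ^ k"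
    "\<And>s. real j \<le> prob (X s) * 2 ^ k \<Longrightarrow> X s \<inter> G \<noteq> {}"
proof -
  \<comment> \<open>The \<open>X s\<close> need not increase with \<open>s\<close>; the
    \<open>Y S\<close> do, and their union is still \<open>H\<close>.\<close>
  define Y where "Y S = (\<Inter>s\<in>{S..}. X s)" for S
  have Y: "Y S \<in> events" for S
    unfolding Y_def using X(1) by (intro sets.countable_INT) auto
  have "incseq Y" unfolding Y_def incseq_def by fastforce
  have H_eq: "(\<Union>S. Y S) = H"
    using X(2,3) unfolding Y_def eventually_sequentially by fastforce
  have H: "H \<in> events" unfolding H_eq[symmetric] using Y by blast
  have lim: "(\<lambda>S. prob (Y S)) \<longlonglongrightarrow> prob H"
    using finite_Lim_measure_incseq[OF _ \<open>incseq Y\<close>] Y unfolding H_eq by blast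
  have GH: "prob G \<le> prob H" using G H by (intro finite_measure_mono)
  \<comment> \<open>The largest integer strictly below \<open>prob H * 2 ^ k\<close>. Strictness
    ensures that the threshold is met; the gap of at most 1 is smaller than
    \<open>prob G * 2 ^ k\<close>.\<close>
  define j where "j = nat (\<lceil>prob H * 2 ^ k\<rceil> - 1)"
  have pos: "prob H * 2 ^ k > 0" using G(3) mult_right_mono[OF GH zero_le_power[of 2 k]] by linarith
  then have "\<lceil>prob H * 2 ^ k\<rceil> \<ge> 1" by simp
  then have "real j = of_int \<lceil>prob H * 2 ^ k\<rceil> - 1" unfolding j_def by simp
  then have j: "real j < prob H * 2 ^ k" "prob H * 2 ^ k - 1 \<le> real j"
    using of_int_ceiling_le_add_one le_of_int_ceiling ceiling_correct[of "prob H * 2 ^ k"] by linarith+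
  show thesis
  proof
    have "prob H * 2 ^ k \<le> 2 ^ k" by (simp add: mult_left_le_one_le)
    then have "real j < 2 ^ k" using j(1) by linarith
    then have "real j < real (2 ^ k)" by (simp only: of_nat_power of_nat_numeral)
    then show "j < 2 ^ k" by (rule of_nat_less_imp_less)
    have "real j / 2 ^ k < prob H" using j(1) by (simp add: field_simps)
    from order_tendstoD(1)[OF lim this] eventually_ge_at_top[of k]
    have "\<forall>\<^sub>F S in sequentially. real j / 2 ^ k < prob (Y S) \<and> k \<le> S"
      by eventually_elim simp
    then obtain S where S: "real j / 2 ^ k < prob (Y S)" "k \<le> S"
      using eventually_happens' sequentially_bot by blast
    have "prob (Y S) \<le> prob (X S)"
      using X(1) unfolding Y_def by (intro finite_measure_mono) auto
    with S have "real j / 2 ^ k \<le> prob (X S)" by linarith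
    with S(2) show "\<exists>s\<ge>k. real j \<le> prob (X s) * 2 ^ k"
      by (intro exI[of _ S]) (simp add: pos_divide_le_eq)
  next
    fix s assume s: "real j \<le> prob (X s) * 2 ^ k"
    show "X s \<inter> G \<noteq> {}"
    proof
      assume "X s \<inter> G = {}"
      then have "prob (X s) + prob G = prob (X s \<union> G)"
        using X(1) G(1) by (intro finite_measure_Union[symmetric])
      also have "\<dots> \<le> prob H" using X(2) G(2) H by (intro finite_measure_mono) auto
      finally have "(prob (X s) + prob G) * 2 ^ k \<le> prob H * 2 ^ k" by (intro mult_right_mono) auto
      then show False using s j(2) G(3) by (simp add: ring_distribs)
    qed
  qed
qed

section \<open>Settled strings and stages as the step bound grows\<close>

definition settles :: "recf \<Rightarrow> recf \<Rightarrow> (nat \<Rightarrow> bool) \<Rightarrow> nat \<Rightarrow> bool" where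
  "settles f u w x \<longleftrightarrow> reval w f [x] 0 \<or> (reval w f [x] 1 \<and> (\<exists>y. reval (\<lambda>_. False) u [x] y))"

lemma settled_imp_settles:
  assumes "settled f u s (pre s w) x"
  shows "settles f u w x"
proof -
  \<comment> \<open>The number \<open>0\<close> is the piece of the all-false oracle, so soundness
    of \<open>sim\<close> applies to \<open>u\<close> as well.\<close>
  consider "sim s (pre s w) f [x] = Suc 0"
    | "sim s (pre s w) f [x] = Suc 1" "sim s (pre s (\<lambda>_. False)) u [x] = Suc (sim s 0 u [x] - 1)"
    using assms unfolding settled_def by force
  then show ?thesis
    unfolding settles_def by cases (use sim_reval in blast)+
qed

lemma settles_imp_settled:
  assumes "settles f u w x"
  shows "\<forall>\<^sub>F s in sequentially. settled f u s (pre s w) x"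
  using assms unfolding settles_def
proof (elim disjE conjE exE)
  assume "reval w f [x] 0"
  then have "\<forall>\<^sub>F s in sequentially. sim s (pre s w) f [x] = Suc 0" by (rule reval_sim)
  then show ?thesis by eventually_elim (simp add: settled_def)
next
  fix y assume "reval w f [x] 1" and "reval (\<lambda>_. False) u [x] y"
  then have "\<forall>\<^sub>F s in sequentially. sim s (pre s w) f [x] = Suc 1"
    "\<forall>\<^sub>F s in sequentially. sim s (pre s (\<lambda>_. False)) u [x] = Suc y"
    by (simp_all only: reval_sim)
  then show ?thesis using eventually_ge_at_top[of y]
    by eventually_elim (simp add: settled_def)
qed

text \<open>Only the finitely many strings of length below \<open>B\<close> are involved, so one
  bound serves all those that settle.\<close>

lemma eventually_stage:
  assumes "\<And>n. n < B \<Longrightarrow> N \<le> n \<Longrightarrow>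
    (\<Sum>x<2 ^ Suc n - 1. of_bool (\<not> settles f u w x)) * b \<le> 2 ^ Suc n"
  shows "\<forall>\<^sub>F s in sequentially. stage f u b N B s (pre s w)"
proof -
  have "\<forall>\<^sub>F s in sequentially. \<forall>x\<in>{..<2 ^ Suc B}. settles f u w x \<longrightarrow> settled f u s (pre s w) x"
    by (intro eventually_ball_finite ballI) (auto intro: settles_imp_settled eventually_mono)
  then show ?thesis
  proof eventually_elim
    case (elim s)
    show ?case unfolding stage_def
    proof (intro allI impI)
      fix n assume n: "n < B" "N \<le> n"
      have "(2::nat) ^ Suc n \<le> 2 ^ Suc B" using n(1) by (intro power_increasing) auto
      then have "x \<in> {..<2 ^ Suc B}" if "x \<in> {..<2 ^ Suc n - 1}" for x :: nat
        using that unfolding lessThan_iff by linarith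
      then have "(\<Sum>x<2 ^ Suc n - 1. of_bool (\<not> settled f u s (pre s w) x)) \<le>
          (\<Sum>x<2 ^ Suc n - 1. of_bool (\<not> settles f u w x) :: nat)"
        using elim by (intro sum_mono)
          (metis (full_types) of_bool_eq(1,2) of_bool_less_eq_one order_refl zero_le)
      from mult_right_mono[OF this zero_le, of b]
      show "(\<Sum>x<2 ^ Suc n - 1. of_bool (\<not> settled f u s (pre s w) x)) * b \<le> 2 ^ Suc n"
        using assms[OF n] by linarith
    qed
  qed
qed

text \<open>A string settled once is settled at all large bounds. This provides the inclusion of
  \<open>X s\<close> in \<open>H\<close> required by \<open>threshold_between\<close>.\<close>

lemma stage_stays:
  assumes "stage f u b N B s (pre s w)"
  shows "\<forall>\<^sub>F t in sequentially. stage f u b N B t (pre t w)"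
proof (rule eventually_stage)
  fix n assume n: "n < B" "N \<le> n"
  have "(\<Sum>x<2 ^ Suc n - 1. of_bool (\<not> settles f u w x)) \<le>
      (\<Sum>x<2 ^ Suc n - 1. of_bool (\<not> settled f u s (pre s w) x) :: nat)"
    by (intro sum_mono) (auto dest: settled_imp_settles)
  from mult_right_mono[OF this zero_le, of b]
  show "(\<Sum>x<2 ^ Suc n - 1. of_bool (\<not> settles f u w x)) * b \<le> 2 ^ Suc n"
    using assms n unfolding stage_def by (meson le_trans zero_le)
qed

section \<open>Error counts, good oracles and the contradiction\<close>

definition errors :: "(bool list \<Rightarrow> nat option) \<Rightarrow> bool list set \<Rightarrow> nat \<Rightarrow> bool list set" where
  "errors \<alpha> A n = {x. length x \<le> n \<and> \<alpha> x \<noteq> Some (if x \<in> A then 1 else 0)}"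

definition good_oracles :: "recf \<Rightarrow> bool list set \<Rightarrow> nat \<Rightarrow> nat \<Rightarrow> (nat \<Rightarrow> bool) set" where
  "good_oracles f A b N = {w. \<forall>n\<ge>N. card (errors (rand_fun f w) A n) * b \<le> 2 ^ Suc n}"

lemma finite_errors: "finite (errors \<alpha> A n)"
  unfolding errors_def by (rule finite_subset[OF _ finite_strings[of n]]) auto

lemma rand_fun_measurable:
  "{w. rand_fun f w x = Some v} \<in> sets coin_space"
proof -
  have "{w. rand_fun f w x = Some v} =
      {w \<in> space coin_space. \<exists>S. \<forall>s. S \<le> s \<longrightarrow> sim s (pre s w) f [str_to_nat x] = Suc v}"
    by (simp add: rand_fun_def compute_eq_Some_iff reval_iff_sim eventually_sequentially)
  also have "\<dots> \<in> sets coin_space" by measurable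
  finally show ?thesis .
qed

lemma good_oracles_measurable: "good_oracles f A b N \<in> sets coin_space"
proof -
  have [measurable]: "Measurable.pred coin_space (\<lambda>w. rand_fun f w x = Some v)" for x v
    using rand_fun_measurable[of f x v] by (simp add: pred_def)
  let ?E = "\<lambda>w n. {x \<in> {x. length x \<le> n}. rand_fun f w x \<noteq> Some (if x \<in> A then 1 else 0)}"
  have "real (card (errors (rand_fun f w) A n)) =
      (\<Sum>x | length x \<le> n. if rand_fun f w x = Some (if x \<in> A then 1 else 0) then 0 else 1)" for w n
  proof -
    have "errors (rand_fun f w) A n = ?E w n" by (auto simp: errors_def)
    then show ?thesis
      using finite_strings[of n] by (simp add: sum.If_cases Int_def Compl_eq)
  qed
  moreover have "m * b \<le> 2 ^ Suc n \<longleftrightarrow> real m * real b \<le> 2 ^ Suc n" for m n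
    by (metis of_nat_le_iff of_nat_mult of_nat_numeral of_nat_power)
  ultimately have "good_oracles f A b N = {w \<in> space coin_space. \<forall>n. N \<le> n \<longrightarrow>
      (\<Sum>x | length x \<le> n. if rand_fun f w x = Some (if x \<in> A then 1 else 0) then 0 else 1) * real b
        \<le> 2 ^ Suc n}"
    unfolding good_oracles_def by (simp only: space_coin_space UNIV_I simp_thms)
  also have "\<dots> \<in> sets coin_space" by measurable
  finally show ?thesis .
qed

lemma good_oracles_null:
  fixes U :: "bool list \<Rightarrow> bool list option"
  assumes "optimal U"
    and c: "\<And>q y. U q = Some y \<Longrightarrow>
      2 ^ str_to_nat q \<le> card (late U (str_to_nat q + c) (str_to_nat y))"
  shows "coin.prob (good_oracles f (dom U) (2 ^ (c + 3)) N) = 0"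
proof (rule ccontr)
  let ?b = "2 ^ (c + 3) :: nat"
  let ?G = "good_oracles f (dom U) ?b N"
  assume "coin.prob ?G \<noteq> 0"
  then have pos: "coin.prob ?G > 0" by (simp add: zero_less_measure_iff)
  obtain u where u: "oracle_free u"
    "\<And>p x. U p = Some x \<longleftrightarrow> reval (\<lambda>_. False) u [str_to_nat p] (str_to_nat x)"
    using assms machineE unfolding optimal_def by blast
  obtain g where g: "oracle_free g" "\<And>r s. enough f u ?b N r s \<Longrightarrow>
      reval (\<lambda>_. False) g [r] (LEAST s. enough f u ?b N r s)"
    using enough_Least_computable[of f u ?b N] by blast
  obtain c' where c': "\<And>p y. reval (\<lambda>_. False) g [str_to_nat p] y \<Longrightarrow>
      \<exists>q. U q = Some (nat_to_str y) \<and> length q \<le> length p + c'"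
    using optimal_simulates[OF assms(1) g(1)] by blast
  \<comment> \<open>The first condition makes the grid of thresholds finer than the probability of
    \<open>?G\<close>; the next two keep \<open>q\<close> within length \<open>2 * k\<close> and
    \<open>n\<close> below \<open>?B\<close>. The last forces \<open>q\<close> to have number at
    least \<open>N\<close>, because its output will be \<open>s \<ge> k\<close>.\<close>
  obtain k where k: "1 < coin.prob ?G * 2 ^ k" "c \<le> k" "c' \<le> k"
    "\<And>q y. str_to_nat q < N \<Longrightarrow> U q = Some y \<Longrightarrow> str_to_nat y < k"
  proof -
    obtain k0 where k0: "(1 / coin.prob ?G :: real) < 2 ^ k0"
      using real_arch_pow[of 2] by auto
    \<comment> \<open>Programs that do not halt contribute arbitrary values, which can only enlarge
      the maximum.\<close>
    let ?M = "Max (insert 0 ((\<lambda>i. str_to_nat (the (U (nat_to_str i)))) ` {..<N}))"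
    let ?k = "k0 + c + c' + Suc ?M"
    show thesis
    proof
      have "(2::real) ^ k0 \<le> 2 ^ ?k" by (intro power_increasing) auto
      then show "1 < coin.prob ?G * 2 ^ ?k"
        using k0 pos by (simp only: pos_divide_less_eq mult.commute[of _ "coin.prob ?G"])
          (meson less_le_trans mult_left_mono less_imp_le)
      fix q y assume "str_to_nat q < N" "U q = Some y"
      then have "str_to_nat y \<in> (\<lambda>i. str_to_nat (the (U (nat_to_str i)))) ` {..<N}"
        by (intro image_eqI[of _ _ "str_to_nat q"]) auto
      then have "str_to_nat y \<le> ?M" by (intro Max_ge) auto
      then show "str_to_nat y < ?k" by linarith
    qed auto
  qed
  let ?B = "2 ^ (2 * k + 1) + k"
  let ?st = "stage f u ?b N ?B"
  have G_ev: "\<forall>\<^sub>F s in sequentially. ?st s (pre s w)" if w: "w \<in> ?G" for w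
  proof (rule eventually_stage)
    fix n assume "N \<le> n"
    \<comment> \<open>A correct answer is 0 off \<open>dom U\<close>, and 1 on \<open>dom U\<close>,
      where \<open>u\<close> halts and confirms it.\<close>
    have "settles f u w (str_to_nat x)" if "x \<notin> errors (rand_fun f w) (dom U) n" "length x \<le> n" for x
      using that u(2) unfolding errors_def settles_def rand_fun_def
      by (auto simp: compute_eq_Some_iff split: if_splits)
    then have "card {x. length x \<le> n \<and> \<not> settles f u w (str_to_nat x)} \<le>
        card (errors (rand_fun f w) (dom U) n)"
      by (intro card_mono finite_errors) auto
    from mult_right_mono[OF this zero_le, of ?b]
    show "(\<Sum>x<2 ^ Suc n - 1. of_bool (\<not> settles f u w x)) * ?b \<le> 2 ^ Suc n"
      using w \<open>N \<le> n\<close> unfolding card_strings_eq_sum[symmetric] good_oracles_def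
      by (blast intro: order_trans)
  qed
  have st_sets: "{w. ?st s (pre s w)} \<in> sets coin_space" for s
  proof -
    have "{w \<in> space coin_space. ?st s (pre s w)} \<in> sets coin_space" by measurable
    then show ?thesis by simp
  qed
  obtain j :: nat where j: "j < 2 ^ k" "\<exists>s\<ge>k. real j \<le> coin.prob {w. ?st s (pre s w)} * 2 ^ k"
    "\<And>s. real j \<le> coin.prob {w. ?st s (pre s w)} * 2 ^ k \<Longrightarrow> {w. ?st s (pre s w)} \<inter> ?G \<noteq> {}"
    by (rule coin.threshold_between[of "\<lambda>s. {w. ?st s (pre s w)}"
          "{w. \<forall>\<^sub>F s in sequentially. ?st s (pre s w)}" ?G k])
      (use st_sets stage_stays good_oracles_measurable G_ev k(1) in auto)
  \<comment> \<open>The string number \<open>j\<close> among those of length \<open>k\<close>,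
    counted from 0; these strings begin at number \<open>2 ^ k - 1\<close>.\<close>
  define r where "r = j + 2 ^ k - 1"
  have r: "length (nat_to_str r) = k" "r + 1 - 2 ^ k = j"
    using j(1) unfolding r_def by (auto intro!: length_nat_to_str_eqI)
  have enough_iff: "enough f u ?b N r s \<longleftrightarrow>
      k \<le> s \<and> real j \<le> coin.prob {w. ?st s (pre s w)} * 2 ^ k" for s
  proof -
    let ?n = "\<Sum>a<2 ^ s. of_bool (?st s a)"
    have "j * 2 ^ s \<le> ?n * 2 ^ k \<longleftrightarrow> real (j * 2 ^ s) \<le> real (?n * 2 ^ k)"
      by (rule of_nat_le_iff[symmetric])
    also have "\<dots> \<longleftrightarrow> real j \<le> real ?n / 2 ^ s * 2 ^ k"
      by (simp add: field_simps del: of_nat_sum of_nat_of_bool sum_of_bool_eq)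
    finally show ?thesis unfolding enough_def Let_def r prob_pre by blast
  qed
  define s where "s = (LEAST s. enough f u ?b N r s)"
  have ex: "\<exists>s. enough f u ?b N r s" using j(2) enough_iff by blast
  then have "enough f u ?b N r s" unfolding s_def by (rule LeastI_ex)
  then have s: "k \<le> s" "real j \<le> coin.prob {w. ?st s (pre s w)} * 2 ^ k"
    using enough_iff by blast+
  \<comment> \<open>The bound \<open>s\<close> was found without an oracle, yet some good oracle has
    reached the stage at \<open>s\<close>.\<close>
  from j(3)[OF s(2)] obtain w where w: "?st s (pre s w)" "w \<in> ?G" by blast
  have "reval (\<lambda>_. False) g [r] s" using ex g(2) unfolding s_def by blast
  then obtain q where q: "U q = Some (nat_to_str s)" "length q \<le> k + c'"
    using c'[of "nat_to_str r" s] r(1) by auto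
  define n where "n = str_to_nat q + c"
  have "N \<le> n" using k(4)[OF _ q(1)] s(1) unfolding n_def by fastforce
  have "str_to_nat q < 2 ^ Suc (2 * k) - 1"
    using q(2) k(3) by (subst length_le_iff[symmetric]) simp
  then have "n < ?B" using k(2) unfolding n_def by simp
  let ?unsettled = "{x. length x \<le> n \<and> \<not> settled f u s (pre s w) (str_to_nat x)}"
  \<comment> \<open>A settled late program cannot have been confirmed with an output of at most
    \<open>s\<close>, so its answer was 0, which is wrong as it halts.\<close>
  have "late U n s \<subseteq> ?unsettled \<union> errors (rand_fun f w) (dom U) n"
  proof
    fix x assume "x \<in> late U n s"
    then obtain y where x: "length x \<le> n" "U x = Some y" "s < str_to_nat y"
      unfolding late_def by auto
    have "x \<in> errors (rand_fun f w) (dom U) n" if st: "settled f u s (pre s w) (str_to_nat x)"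
    proof -
      have "\<not> (0 < sim s 0 u [str_to_nat x] \<and> sim s 0 u [str_to_nat x] \<le> Suc s)"
      proof
        assume *: "0 < sim s 0 u [str_to_nat x] \<and> sim s 0 u [str_to_nat x] \<le> Suc s"
        then have "sim s (pre s (\<lambda>_. False)) u [str_to_nat x] = Suc (sim s 0 u [str_to_nat x] - 1)"
          by simp
        from reval_deterministic[OF sim_reval[OF this]] * x(2,3) u(2) show False by fastforce
      qed
      then have "sim s (pre s w) f [str_to_nat x] = Suc 0" using st unfolding settled_def by auto
      then have "rand_fun f w x = Some 0"
        unfolding rand_fun_def compute_eq_Some_iff by (rule sim_reval)
      then show ?thesis using x unfolding errors_def by auto
    qed
    then show "x \<in> ?unsettled \<union> errors (rand_fun f w) (dom U) n" using x(1) by blast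
  qed
  moreover have "finite ?unsettled"
    by (rule finite_subset[OF _ finite_strings[of n]]) auto
  ultimately have "card (late U n s) \<le> card ?unsettled + card (errors (rand_fun f w) (dom U) n)"
    using finite_errors by (meson card_mono card_Un_le finite_UnI le_trans)
  then have "2 ^ str_to_nat q \<le> card ?unsettled + card (errors (rand_fun f w) (dom U) n)"
    using c[OF q(1)] unfolding n_def by simp
  from mult_le_mono1[OF this, of ?b] have "2 ^ str_to_nat q * ?b \<le>
      card ?unsettled * ?b + card (errors (rand_fun f w) (dom U) n) * ?b"
    by (simp only: add_mult_distrib)
  moreover have "card ?unsettled * ?b \<le> 2 ^ Suc n"
    using w(1) \<open>N \<le> n\<close> \<open>n < ?B\<close> unfolding stage_def card_strings_eq_sum[symmetric] by blast
  moreover have "card (errors (rand_fun f w) (dom U) n) * ?b \<le> 2 ^ Suc n"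
    using w(2) \<open>N \<le> n\<close> unfolding good_oracles_def by blast
  ultimately have "2 ^ str_to_nat q * ?b \<le> 2 ^ Suc n + 2 ^ Suc n" by linarith
  \<comment> \<open>With \<open>m\<close> the number of \<open>q\<close>, the left side is
    \<open>2 ^ (m + c + 3)\<close> and the right side only \<open>2 ^ (m + c + 2)\<close>; this is
    where the exponent \<open>c + 3\<close> comes from.\<close>
  then show False unfolding n_def by (simp add: power_add)
qed

theorem theorem5p3:
  fixes U :: "bool list \<Rightarrow> bool list option"
  assumes "optimal U"
  shows "\<exists>\<epsilon>::real. \<epsilon> > 0 \<and>
    (\<forall>f::recf. \<exists>N \<in> sets coin_space. emeasure coin_space N = 0 \<and>
        {w \<in> space coin_space. upper_err (rand_fun f w) (dom U) < ereal \<epsilon>} \<subseteq> N)"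
proof -
  obtain c where c: "\<And>q y. U q = Some y \<Longrightarrow>
      2 ^ str_to_nat q \<le> card (late U (str_to_nat q + c) (str_to_nat y))"
    using card_late_ge[OF assms] by blast
  let ?b = "2 ^ (c + 3) :: nat"
  show ?thesis
  proof (intro exI[of _ "1 / real ?b"] conjI allI)
    fix f
    have null: "good_oracles f (dom U) ?b N \<in> null_sets coin_space" for N
      using good_oracles_null[OF assms c, of f N] good_oracles_measurable[of f "dom U" ?b N]
      by (simp add: null_sets_def coin.emeasure_eq_measure)
    \<comment> \<open>A strict bound on the limsup holds for the error fractions from some
      \<open>N\<close> on. The countable union over \<open>N\<close> therefore covers all successful
      oracles, whether or not these form a measurable set.\<close>
    let ?Z = "\<Union>N. good_oracles f (dom U) ?b N"
    have "?Z \<in> null_sets coin_space" using null by (rule null_sets_UN)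
    moreover have "w \<in> ?Z" if "upper_err (rand_fun f w) (dom U) < ereal (1 / real ?b)" for w
    proof -
      have "\<forall>\<^sub>F n in sequentially. ereal (err_frac (rand_fun f w) (dom U) n) < ereal (1 / real ?b)"
        using that unfolding upper_err_def by (rule Limsup_lessD)
      then obtain N where N: "\<And>n. N \<le> n \<Longrightarrow> err_frac (rand_fun f w) (dom U) n < 1 / real ?b"
        unfolding eventually_sequentially by auto
      have "card (errors (rand_fun f w) (dom U) n) * ?b \<le> 2 ^ Suc n" if "N \<le> n" for n
      proof -
        let ?e = "card (errors (rand_fun f w) (dom U) n)" and ?l = "2 ^ Suc n - 1 :: nat"
        have l: "?l > 0" using one_less_power[of "2::nat" "Suc n"] by linarith
        have "real ?e / real ?l < 1 / real ?b"
          using N[OF that] unfolding err_frac_def errors_def card_strings .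
        then have "real ?e * real ?b < real ?l" using l by (simp add: field_simps del: power_Suc)
        then have "?e * ?b < ?l" by (simp only: of_nat_mult[symmetric] of_nat_less_iff)
        then show ?thesis by linarith
      qed
      then show ?thesis unfolding good_oracles_def by blast
    qed
    ultimately show "\<exists>N\<in>sets coin_space. emeasure coin_space N = 0 \<and>
        {w \<in> space coin_space. upper_err (rand_fun f w) (dom U) < ereal (1 / real ?b)} \<subseteq> N"
      by (intro bexI[of _ ?Z]) auto
  qed simp
qed

end
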